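(* For each barrier $B$ with base $\mathbb{N}$, $\mathsf{FS}^B\leq_{\mathrm{sW}}\mathsf{RT}^{B^+}_2$.
   Context: $\mathbb{N}$ is the set of natural numbers (including $0$). Subsets of $\mathbb{N}$ are identified with their strictly increasing enumerations; $s\sqsubset Y$ means that $s$ is a proper initial segment of $Y$ as a sequence; $\subset$ is strict set inclusion. A set $B$ of finite subsets of $\mathbb{N}$ is a barrier on an infinite set $X\subseteq\mathbb{N}$ if: (1) $\bigcup B=X$; (2) for all $s,t\in B$, $s\not\subset t$; (3) for every infinite $Y\subseteq X$ there is $s\in B$ with $s\sqsubset Y$. The set $X=\bigcup B$ is the base of $B$. For infinite $Y\subseteq X$, $B\vert Y=\{s\in B: s\subseteq Y\}$ (this is a barrier on $Y$, and every barrier $B'\subseteq B$ has this form). For a barrier $B$ with base $X$, put $X^+=\{x+1:x\in X\}$, $s^+=\{x+1:x\in s\}$ for $s\in B$, and $B^+=\{s^+\cup\{m\}: s\in B,\ m\in X^+,\ m>\max(s)+1\}$; $B^+$ is a barrier with base $X^+$. $\mathsf{FS}^B$ is the problem whose instances are the functions $f:B\to\mathbb{N}$, where a solution to $f$ is an infinite $Y$ contained in the base of $B$ such that for all $s\in B\vert Y$, if $f(s)\in Y$ then $f(s)\in s$. For a barrier $C$ and a positive integer $k$, $\mathsf{RT}^C_k$ is the problem whose instances are the functions $g:C\to k=\{0,\dots,k-1\}$, where a solution to $g$ is an infinite subset $H$ of the base of $C$ such that $g$ is constant on $C\vert H$. Instances and solutions are coded as subsets of $\mathbb{N}$ in a standard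 way, a coloring being given together with its domain (so that the barrier is uniformly computable from a coloring of it). For such problems $\mathsf{P},\mathsf{Q}$, $\mathsf{Q}\leq_{\mathrm{sW}}\mathsf{P}$ (strong Weihrauch reducibility) means: there are Turing functionals $\Phi,\Psi$ such that for every instance $I$ of $\mathsf{Q}$, $\Phi(I)$ is an instance of $\mathsf{P}$, and for every solution $\hat Y$ to $\Phi(I)$, $\Psi(\hat Y)$ is a solution to $I$ for $\mathsf{Q}$. *)

theory Defs
  imports "HOL-Library.Nat_Bijection" "HOL-Library.Infinite_Set"
begin

section \<open>Barriers\<close>

definition proper_initial_segment :: "nat set \<Rightarrow> nat set \<Rightarrow> bool" (infix \<open>\<sqsubset>\<close> 50) where
  "s \<sqsubset> Y \<longleftrightarrow> s \<subset> Y \<and> (\<forall>x\<in>s. \<forall>y\<in>Y. y < x \<longrightarrow> y \<in> s)"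

text \<open>Agreement with the reading of sets as their increasing enumerations:\<close>

lemma proper_initial_segment_iff_enumerate:
  assumes "infinite Y"
  shows "finite s \<and> s \<sqsubset> Y \<longleftrightarrow> (\<exists>n. s = enumerate Y ` {..<n})"
proof
  assume A: "finite s \<and> s \<sqsubset> Y"
  define I where "I = {i. enumerate Y i \<in> s}"
  have s: "s = enumerate Y ` I"
    using A range_enumerate[OF assms] unfolding I_def proper_initial_segment_def by auto
  have fin: "finite I"
    using A s finite_imageD[of "enumerate Y" I] inj_enumerate[OF assms] by (metis inj_on_subset subset_UNIV)
  have down: "j \<in> I" if "i \<in> I" "j < i" for i j
    using that A enumerate_mono[OF that(2) assms] enumerate_in_set[OF assms, of j]
    unfolding I_def proper_initial_segment_def by blast
  have "\<exists>n. I = {..<n}"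
  proof (cases "I = {}")
    case False
    have "I = {..<Suc (Max I)}"
      using fin down Max_in[OF fin False] by (auto simp: less_Suc_eq_le) (metis le_neq_implies_less)
    then show ?thesis by blast
  qed auto
  then show "\<exists>n. s = enumerate Y ` {..<n}" using s by blast
next
  assume "\<exists>n. s = enumerate Y ` {..<n}"
  then obtain n where s: "s = enumerate Y ` {..<n}" by blast
  have fin: "finite s" using s by simp
  have sub: "s \<subset> Y" using s fin assms enumerate_in_set[OF assms] by blast
  have "y \<in> s" if xs: "x \<in> s" and yY: "y \<in> Y" and yx: "y < x" for x y
  proof -
    obtain i where i: "i < n" "x = enumerate Y i" using xs s by auto
    obtain j where j: "y = enumerate Y j" using yY range_enumerate[OF assms] by blast
    have "j < i" using yx i j enumerate_mono_iff[OF assms] by simp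
    then show ?thesis using i j s by auto
  qed
  then show "finite s \<and> s \<sqsubset> Y" using fin sub unfolding proper_initial_segment_def by blast
qed

definition barrier_on :: "nat set set \<Rightarrow> nat set \<Rightarrow> bool" where
  "barrier_on B X \<longleftrightarrow>
     infinite X \<and> (\<forall>s\<in>B. finite s) \<and>
     \<Union>B = X \<and>
     (\<forall>s\<in>B. \<forall>t\<in>B. \<not> s \<subset> t) \<and>
     (\<forall>Y. infinite Y \<and> Y \<subseteq> X \<longrightarrow> (\<exists>s\<in>B. s \<sqsubset> Y))"

definition barrier_restrict :: "nat set set \<Rightarrow> nat set \<Rightarrow> nat set set" where
  "barrier_restrict B Y = {s \<in> B. s \<subseteq> Y}"

definition barrier_plus :: "nat set set \<Rightarrow> nat set set" where
  "barrier_plus B =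
     {(Suc ` s) \<union> {m} | s m. s \<in> B \<and> m \<in> Suc ` (\<Union>B) \<and> m > Max s + 1}"


section \<open>Turing functionals\<close>

text \<open>
  Programs for the functions partial recursive in an oracle set \<open>X\<close>. The index \<open>e\<close> is independent
  of the oracle, so \<open>X \<mapsto> recf_val X e\<close> is a Turing functional; \<open>None\<close> means divergence
  (or a missing argument).
\<close>

datatype recf =
    RZero
  | RSucc
  | RProj nat
  | ROracle
  | RComp recf "recf list"
  | RPrim recf recf
  | RMu recf

fun recf_val :: "nat set \<Rightarrow> recf \<Rightarrow> nat list \<Rightarrow> nat option" where
  "recf_val X RZero xs = Some 0"
| "recf_val X RSucc xs = (case xs of [] \<Rightarrow> None | x # _ \<Rightarrow> Some (Suc x))"
| "recf_val X (RProj i) xs = (if i < length xs then Some (xs ! i) else None)"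
| "recf_val X ROracle xs = (case xs of [] \<Rightarrow> None | x # _ \<Rightarrow> Some (of_bool (x \<in> X)))"
| "recf_val X (RComp f gs) xs =
     Option.bind (those (map (\<lambda>g. recf_val X g xs) gs)) (recf_val X f)"
| "recf_val X (RPrim f g) xs =
     (case xs of
        [] \<Rightarrow> None
      | n # ys \<Rightarrow>
          rec_nat (recf_val X f ys) (\<lambda>k r. Option.bind r (\<lambda>y. recf_val X g (k # y # ys))) n)"
| "recf_val X (RMu f) xs =
     (let P = (\<lambda>n. recf_val X f (n # xs) = Some 0 \<and>
                   (\<forall>i<n. \<exists>y>0. recf_val X f (i # xs) = Some y))
      in if \<exists>n. P n then Some (THE n. P n) else None)"

text \<open>The functional with index \<open>e\<close> maps the oracle \<open>X\<close> to (the characteristic function of) \<open>A\<close>.\<close>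

definition computes :: "recf \<Rightarrow> nat set \<Rightarrow> nat set \<Rightarrow> bool" where
  "computes e X A \<longleftrightarrow> (\<forall>n. recf_val X e [n] = Some (of_bool (n \<in> A)))"

lemma computes_unique: "computes e X A \<Longrightarrow> computes e X A' \<Longrightarrow> A = A'"
  unfolding computes_def by (metis (full_types) of_bool_eq_iff option.inject set_eqI)


section \<open>Problems and strong Weihrauch reducibility\<close>

datatype problem =
  Problem (instances: "nat set set") (solutions: "nat set \<Rightarrow> nat set set")

definition strong_Weihrauch_le :: "problem \<Rightarrow> problem \<Rightarrow> bool" (infix \<open>\<le>\<^sub>s\<^sub>W\<close> 50) where
  "Q \<le>\<^sub>s\<^sub>W P \<longleftrightarrow>
     (\<exists>\<Phi> \<Psi>. \<forall>I \<in> instances Q.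
        \<exists>J. computes \<Phi> I J \<and> J \<in> instances P \<and>
            (\<forall>Y \<in> solutions P J. \<exists>Z. computes \<Psi> Y Z \<and> Z \<in> solutions Q I))"

text \<open>
  A coloring is coded by the join of its domain and its graph, so that the domain is uniformly
  computable (and not merely enumerable) from the code.
\<close>

definition coloring_code :: "nat set set \<Rightarrow> (nat set \<Rightarrow> nat) \<Rightarrow> nat set" where
  "coloring_code B f =
     {sum_encode (Inl (set_encode s)) | s. s \<in> B} \<union>
     {sum_encode (Inr (prod_encode (set_encode s, f s))) | s. s \<in> B}"

lemma coloring_code_eq_iff:
  assumes "\<forall>s\<in>B. finite s" and "\<forall>s\<in>C. finite s"
  shows "coloring_code B f = coloring_code C g \<longleftrightarrow> B = C \<and> (\<forall>s\<in>B. f s = g s)"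
proof
  assume eq: "coloring_code B f = coloring_code C g"
  have dom: "sum_encode (Inl (set_encode s)) \<in> coloring_code D h \<longleftrightarrow> s \<in> D"
    if "finite s" "\<forall>t\<in>D. finite t" for s D h
    using that by (auto simp: coloring_code_def sum_encode_eq set_encode_eq)
  have graph: "sum_encode (Inr (prod_encode (set_encode s, k))) \<in> coloring_code D h
      \<longleftrightarrow> s \<in> D \<and> h s = k"
    if "finite s" "\<forall>t\<in>D. finite t" for s D h k
    using that by (auto simp: coloring_code_def sum_encode_eq set_encode_eq prod_encode_eq)
  have "s \<in> B \<longleftrightarrow> s \<in> C" for s
  proof (cases "finite s")
    case True
    show ?thesis using dom[OF True assms(1), of f] dom[OF True assms(2), of g] eq by simp
  qed (use assms in blast)
  then have "B = C" by blast
  moreover have "f s = g s" if "s \<in> B" for s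
    using graph[of s B "f s" f] graph[of s C "f s" g] eq assms that by simp
  ultimately show "B = C \<and> (\<forall>s\<in>B. f s = g s)" by blast
qed (auto simp: coloring_code_def)

definition free_for :: "nat set set \<Rightarrow> (nat set \<Rightarrow> nat) \<Rightarrow> nat set \<Rightarrow> bool" where
  "free_for B f Y \<longleftrightarrow>
     infinite Y \<and> Y \<subseteq> \<Union>B \<and> (\<forall>s \<in> barrier_restrict B Y. f s \<in> Y \<longrightarrow> f s \<in> s)"

definition homogeneous_for :: "nat set set \<Rightarrow> (nat set \<Rightarrow> nat) \<Rightarrow> nat set \<Rightarrow> bool" where
  "homogeneous_for C g H \<longleftrightarrow>
     infinite H \<and> H \<subseteq> \<Union>C \<and> (\<exists>c. \<forall>s \<in> barrier_restrict C H. g s = c)"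

text \<open>
  In both problems the coloring is determined on the barrier by its code, and values
  off the barrier are irrelevant.
\<close>

definition FS :: "nat set set \<Rightarrow> problem" where
  "FS B = Problem
     {coloring_code B f | f. True}
     (\<lambda>I. {Y. \<exists>f. I = coloring_code B f \<and> free_for B f Y})"

definition RT :: "nat set set \<Rightarrow> nat \<Rightarrow> problem" where
  "RT C k = Problem
     {coloring_code C g | g. \<forall>s\<in>C. g s < k}
     (\<lambda>J. {H. \<exists>g. J = coloring_code C g \<and> homogeneous_for C g H})"

end

theory Submission imports Defs begin

text \<open>
  For \<open>s \<in> B\<close> with \<open>f s \<notin> s\<close> and \<open>f s < Max s\<close>, let \<open>u\<close> be the initial segment of
  \<open>s \<union> {f s}\<close> that lies in \<open>B\<close>. Since \<open>Max u < Max s\<close>, iterating \<open>s \<mapsto> u\<close> stops; let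
  \<open>depth s\<close> be the number of steps. Color \<open>s\<^sup>+ \<union> {m + 1}\<close> by
  \<open>depth s + [m = f s]\<close> modulo 2, let \<open>H\<close> be homogeneous and shift \<open>H\<close> down by one to \<open>Y\<close>.
  Suppose \<open>s \<subseteq> Y\<close> and \<open>f s \<in> Y - s\<close>. If \<open>f s < Max s\<close>, then \<open>u \<subseteq> Y\<close>, and for a large
  \<open>m\<close> the sets \<open>s\<close> and \<open>u\<close> yield different colors. If \<open>f s > Max s\<close>, then
  \<open>m = f s\<close> and a larger \<open>m \<in> Y\<close> yield different colors. So \<open>Y\<close> is free for \<open>f\<close>.
\<close>

section \<open>Closure properties of functionals total on a class of oracles\<close>

text \<open>A single index \<open>e\<close> serves every oracle in \<open>D\<close>, so
  \<open>F\<close> is given by one Turing functional. The class \<open>D\<close> restricts the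
  oracles because the searches below are guaranteed to halt only on codes of colorings of the
  barrier.\<close>

definition computable_on :: "nat set set \<Rightarrow> nat \<Rightarrow> (nat set \<Rightarrow> nat list \<Rightarrow> nat) \<Rightarrow> bool" where
  "computable_on D k F \<longleftrightarrow>
     (\<exists>e. \<forall>X\<in>D. \<forall>xs. length xs = k \<longrightarrow> recf_val X e xs = Some (F X xs))"

abbreviation decidable_on :: "nat set set \<Rightarrow> nat \<Rightarrow> (nat set \<Rightarrow> nat list \<Rightarrow> bool) \<Rightarrow> bool" where
  "decidable_on D k P \<equiv> computable_on D k (\<lambda>X xs. of_bool (P X xs))"

abbreviation computable1 :: "nat set set \<Rightarrow> (nat set \<Rightarrow> nat \<Rightarrow> nat) \<Rightarrow> bool" where
  "computable1 D f \<equiv> computable_on D 1 (\<lambda>X xs. f X (xs ! 0))"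

abbreviation computable2 :: "nat set set \<Rightarrow> (nat set \<Rightarrow> nat \<Rightarrow> nat \<Rightarrow> nat) \<Rightarrow> bool" where
  "computable2 D f \<equiv> computable_on D 2 (\<lambda>X xs. f X (xs ! 0) (xs ! 1))"

section \<open>Composition, primitive recursion and minimization\<close>

lemma computable_on_cong:
  assumes "\<And>X xs. X \<in> D \<Longrightarrow> length xs = k \<Longrightarrow> F X xs = G X xs"
  shows "computable_on D k F \<longleftrightarrow> computable_on D k G"
  using assms by (simp add: computable_on_def)

lemma computable_nth: "i < k \<Longrightarrow> computable_on D k (\<lambda>X xs. xs ! i)"
  unfolding computable_on_def by (rule exI[of _ "RProj i"]) auto

text \<open>Minimization puts the sought number in front of the arguments, so the old parameters
  reappear under \<open>tl\<close>.\<close>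

lemma computable_tl_nth: "Suc i < k \<Longrightarrow> computable_on D k (\<lambda>X xs. tl xs ! i)"
  unfolding computable_on_def by (rule exI[of _ "RProj (Suc i)"]) (auto simp: nth_tl)

lemma computable1_app:
  assumes "computable1 D f" and "computable_on D k G"
  shows "computable_on D k (\<lambda>X xs. f X (G X xs))"
proof -
  obtain e where e: "\<forall>X\<in>D. \<forall>xs. length xs = 1 \<longrightarrow> recf_val X e xs = Some (f X (xs ! 0))"
    using assms(1) unfolding computable_on_def by blast
  obtain d where d: "\<forall>X\<in>D. \<forall>xs. length xs = k \<longrightarrow> recf_val X d xs = Some (G X xs)"
    using assms(2) unfolding computable_on_def by blast
  show ?thesis
    unfolding computable_on_def by (rule exI[of _ "RComp e [d]"]) (use d e in simp)
qed

lemma computable2_app: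
  assumes "computable2 D f" and "computable_on D k G" and "computable_on D k H"
  shows "computable_on D k (\<lambda>X xs. f X (G X xs) (H X xs))"
proof -
  obtain e where e: "\<forall>X\<in>D. \<forall>xs. length xs = 2 \<longrightarrow> recf_val X e xs = Some (f X (xs ! 0) (xs ! 1))"
    using assms(1) unfolding computable_on_def by blast
  obtain d where d: "\<forall>X\<in>D. \<forall>xs. length xs = k \<longrightarrow> recf_val X d xs = Some (G X xs)"
    using assms(2) unfolding computable_on_def by blast
  obtain c where c: "\<forall>X\<in>D. \<forall>xs. length xs = k \<longrightarrow> recf_val X c xs = Some (H X xs)"
    using assms(3) unfolding computable_on_def by blast
  show ?thesis
    unfolding computable_on_def by (rule exI[of _ "RComp e [d, c]"]) (use c d e in simp)
qed

lemma computable_Suc: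
  assumes "computable_on D k F"
  shows "computable_on D k (\<lambda>X xs. Suc (F X xs))"
proof (rule computable1_app[OF _ assms])
  show "computable1 D (\<lambda>X. Suc)"
    unfolding computable_on_def by (rule exI[of _ RSucc]) (auto simp: length_Suc_conv)
qed

lemma decidable_oracle:
  assumes "computable_on D k F"
  shows "decidable_on D k (\<lambda>X xs. F X xs \<in> X)"
proof (rule computable1_app[OF _ assms])
  show "computable1 D (\<lambda>X x. of_bool (x \<in> X))"
    unfolding computable_on_def by (rule exI[of _ ROracle]) (auto simp: length_Suc_conv)
qed

lemma computable_zero: "computable_on D k (\<lambda>X xs. 0)"
  unfolding computable_on_def by (rule exI[of _ RZero]) auto

lemma computable_const: "computable_on D k (\<lambda>X xs. c)"
  by (induction c) (auto intro: computable_zero computable_Suc)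

lemma computable2_rec_nat:
  assumes "computable1 D a"
    and "computable_on D 3 (\<lambda>X xs. b X (xs ! 0) (xs ! 1) (xs ! 2))"
  shows "computable2 D (\<lambda>X n x. rec_nat (a X x) (\<lambda>i r. b X i r x) n)"
proof -
  obtain e where e: "\<forall>X\<in>D. \<forall>xs. length xs = 1 \<longrightarrow> recf_val X e xs = Some (a X (xs ! 0))"
    using assms(1) unfolding computable_on_def by blast
  obtain d where d: "\<forall>X\<in>D. \<forall>xs. length xs = 3 \<longrightarrow>
      recf_val X d xs = Some (b X (xs ! 0) (xs ! 1) (xs ! 2))"
    using assms(2) unfolding computable_on_def by blast
  have rec: "rec_nat (recf_val X e [x]) (\<lambda>k r. Option.bind r (\<lambda>y. recf_val X d [k, y, x])) n =
      Some (rec_nat (a X x) (\<lambda>i r. b X i r x) n)" if "X \<in> D" for X x n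
    using that d e by (induction n) auto
  show ?thesis
    unfolding computable_on_def
    by (rule exI[of _ "RPrim e d"]) (use rec in \<open>auto simp: length_Suc_conv numeral_2_eq_2\<close>)
qed

lemma computable_Least:
  assumes P: "decidable_on D (Suc k) (\<lambda>X xs. P X (xs ! 0) (tl xs))"
    and total: "\<And>X xs. X \<in> D \<Longrightarrow> length xs = k \<Longrightarrow> \<exists>n. P X n xs"
  shows "computable_on D k (\<lambda>X xs. LEAST n. P X n xs)"
proof -
  \<comment> \<open>This recursion sends 0 to 1 and everything else to 0. The flip is required
    because \<open>RMu\<close> looks for a zero, while truth has value 1.\<close>
  have "computable1 D (\<lambda>X x. rec_nat 1 (\<lambda>i r. 0) x)"
    by (rule computable2_app[OF computable2_rec_nat[OF computable_const computable_const]
        computable_nth computable_nth]) auto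
  from computable1_app[OF this P] obtain e where
    "\<forall>X\<in>D. \<forall>xs. length xs = Suc k \<longrightarrow>
       recf_val X e xs = Some (rec_nat 1 (\<lambda>i r. 0) (of_bool (P X (xs ! 0) (tl xs)) :: nat))"
    unfolding computable_on_def by blast
  then have e: "recf_val X e (n # xs) = Some (of_bool (\<not> P X n xs))"
    if "X \<in> D" "length xs = k" for X n and xs :: "nat list"
    using that by (auto simp: of_bool_def)
  show ?thesis
    unfolding computable_on_def
  proof (rule exI[of _ "RMu e"], intro ballI allI impI)
    fix X and xs :: "nat list" assume X: "X \<in> D" "length xs = k"
    have iff: "(recf_val X e (n # xs) = Some 0 \<and> (\<forall>i<n. \<exists>y>0. recf_val X e (i # xs) = Some y))
        \<longleftrightarrow> n = (LEAST n. P X n xs)" for n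
      using total[OF X] by (auto simp: e[OF X] dest: not_less_Least
          intro: LeastI_ex Least_equality[symmetric] leI)
    show "recf_val X (RMu e) xs = Some (LEAST n. P X n xs)"
      by (simp add: iff del: ex_simps)
  qed
qed

section \<open>Arithmetic by primitive recursion\<close>

lemma computable_add:
  assumes "computable_on D k F" and "computable_on D k G"
  shows "computable_on D k (\<lambda>X xs. F X xs + G X xs)"
proof (rule computable2_app[OF _ assms])
  have "rec_nat m (\<lambda>i. Suc) n = n + m" for n m :: nat
    by (induction n) auto
  moreover have "computable2 D (\<lambda>X n m. rec_nat m (\<lambda>i. Suc) n)"
    by (intro computable2_rec_nat computable_Suc computable_nth) auto
  ultimately show "computable2 D (\<lambda>X n m. n + m)"
    by simp
qed

lemma computable_diff:
  assumes "computable_on D k F" and "computable_on D k G"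
  shows "computable_on D k (\<lambda>X xs. F X xs - G X xs)"
proof (rule computable2_app[OF _ assms(2,1)])
  \<comment> \<open>Discarding the previous value and returning the index gives the predecessor;
    iterating it gives truncated subtraction, by recursion on the subtrahend.\<close>
  have "rec_nat 0 (\<lambda>i r. i) n = n - 1" for n :: nat
    by (cases n) auto
  moreover have "computable2 D (\<lambda>X n x. rec_nat 0 (\<lambda>i r. i) n)"
    by (intro computable2_rec_nat computable_const computable_nth) auto
  ultimately have pred: "computable1 D (\<lambda>X n. n - 1)"
    using computable2_app[of D "\<lambda>X n x. n - 1", OF _ computable_nth computable_nth, of 0 1 0] by simp
  have "rec_nat m (\<lambda>i r. r - 1) n = m - n" for n m :: nat
    by (induction n) auto
  moreover have "computable2 D (\<lambda>X n m. rec_nat m (\<lambda>i r. r - 1) n)"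
    by (intro computable2_rec_nat computable1_app[OF pred] computable_nth) auto
  ultimately show "computable2 D (\<lambda>X n m. m - n)"
    by simp
qed

lemma computable_mult:
  assumes "computable_on D k F" and "computable_on D k G"
  shows "computable_on D k (\<lambda>X xs. F X xs * G X xs)"
proof (rule computable2_app[OF _ assms])
  have "rec_nat 0 (\<lambda>i r. r + m) n = n * m" for n m :: nat
    by (induction n) auto
  moreover have "computable2 D (\<lambda>X n m. rec_nat 0 (\<lambda>i r. r + m) n)"
    by (intro computable2_rec_nat computable_add computable_const computable_nth) auto
  ultimately show "computable2 D (\<lambda>X n m. n * m)"
    by simp
qed

lemma computable_power2:
  assumes "computable_on D k F"
  shows "computable_on D k (\<lambda>X xs. 2 ^ F X xs)"
proof -
  have "rec_nat 1 (\<lambda>i r. 2 * r) n = (2 ^ n :: nat)" for n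
    by (induction n) auto
  moreover have "computable2 D (\<lambda>X n x. rec_nat 1 (\<lambda>i r. 2 * r) n)"
    by (intro computable2_rec_nat computable_mult computable_const computable_nth) auto
  ultimately show ?thesis
    using computable2_app[of D "\<lambda>X n x. 2 ^ n", OF _ assms assms] by (simp only:)
qed

lemma computable_funpow:
  assumes h: "computable1 D h" and "computable_on D k N" and "computable_on D k F"
  shows "computable_on D k (\<lambda>X xs. (h X ^^ N X xs) (F X xs))"
proof (rule computable2_app[OF _ assms(2,3)])
  have "rec_nat x (\<lambda>i. h X) n = (h X ^^ n) x" for X n x
    by (induction n) auto
  moreover have "computable2 D (\<lambda>X n x. rec_nat x (\<lambda>i. h X) n)"
    by (intro computable2_rec_nat computable1_app[OF h] computable_nth) auto
  ultimately show "computable2 D (\<lambda>X n. h X ^^ n)"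
    by simp
qed

section \<open>Boolean operations and comparisons\<close>

lemma decidable_not:
  assumes "decidable_on D k P"
  shows "decidable_on D k (\<lambda>X xs. \<not> P X xs)"
proof -
  have "1 - of_bool b = (of_bool (\<not> b) :: nat)" for b
    by simp
  then show ?thesis
    using computable_diff[OF computable_const[of D k 1] assms] by (simp only:)
qed

lemma decidable_conj:
  assumes "decidable_on D k P" and "decidable_on D k Q"
  shows "decidable_on D k (\<lambda>X xs. P X xs \<and> Q X xs)"
  using computable_mult[OF assms] by (simp add: of_bool_conj)

lemma decidable_disj:
  assumes "decidable_on D k P" and "decidable_on D k Q"
  shows "decidable_on D k (\<lambda>X xs. P X xs \<or> Q X xs)"
  using decidable_not[OF decidable_conj[OF decidable_not[OF assms(1)] decidable_not[OF assms(2)]]]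
  by simp

lemma decidable_le:
  assumes "computable_on D k F" and "computable_on D k G"
  shows "decidable_on D k (\<lambda>X xs. F X xs \<le> G X xs)"
proof -
  have "1 - (m - n) = of_bool (m \<le> n)" for m n :: nat
    by auto
  then show ?thesis
    using computable_diff[OF computable_const[of D k 1] computable_diff[OF assms]] by simp
qed

lemma decidable_less:
  assumes "computable_on D k F" and "computable_on D k G"
  shows "decidable_on D k (\<lambda>X xs. F X xs < G X xs)"
  using decidable_le[OF computable_Suc[OF assms(1)] assms(2)] by (simp add: Suc_le_eq)

lemma decidable_eq:
  assumes "computable_on D k F" and "computable_on D k G"
  shows "decidable_on D k (\<lambda>X xs. F X xs = G X xs)"
  using decidable_conj[OF decidable_le[OF assms] decidable_le[OF assms(2,1)]]
  by (simp add: eq_iff[symmetric])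

lemmas computable_intros =
  computable_nth computable_tl_nth computable_const computable_Suc computable_add computable_diff
  computable_mult computable_power2 decidable_oracle decidable_not decidable_conj decidable_disj
  decidable_le decidable_less decidable_eq

section \<open>Division, pairing and bounded quantification\<close>

lemma computable_div:
  assumes "computable_on D k F" and "computable_on D k G"
    and pos: "\<And>X xs. X \<in> D \<Longrightarrow> length xs = k \<Longrightarrow> 0 < G X xs"
  shows "computable_on D k (\<lambda>X xs. F X xs div G X xs)"
proof -
  have ex: "\<exists>q. (y::nat) = 0 \<or> x < Suc q * y" for x y
    by (cases y) (auto intro!: exI[of _ x])
  \<comment> \<open>The disjunct \<open>y = 0\<close> makes the search halt on all pairs;
    \<open>pos\<close> excludes that case for the values actually substituted.\<close>
  have "computable2 D (\<lambda>X x y. LEAST q. y = 0 \<or> x < Suc q * y)"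
  proof (rule computable_Least)
    show "\<exists>q. xs ! 1 = 0 \<or> xs ! 0 < Suc q * xs ! 1" for xs :: "nat list"
      by (rule ex)
  qed (intro computable_intros; simp)
  from computable2_app[OF this assms(1,2)]
  have c: "computable_on D k (\<lambda>X xs. LEAST q. G X xs = 0 \<or> F X xs < Suc q * G X xs)" .
  have eq: "(LEAST q. y = 0 \<or> x < Suc q * y) = x div y" if "0 < y" for x y :: nat
  proof (rule Least_equality)
    show "y = 0 \<or> x < Suc (x div y) * y"
      using that dividend_less_div_times[of y x] by (simp add: add.commute)
    show "x div y \<le> q" if "y = 0 \<or> x < Suc q * y" for q
      using that \<open>0 < y\<close> less_mult_imp_div_less[of x "Suc q" y] by simp
  qed
  from c show ?thesis
    by (rule computable_on_cong[THEN iffD1, rotated]) (use eq pos in blast)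
qed

lemma computable_mod:
  assumes "computable_on D k F" and "computable_on D k G"
    and pos: "\<And>X xs. X \<in> D \<Longrightarrow> length xs = k \<Longrightarrow> 0 < G X xs"
  shows "computable_on D k (\<lambda>X xs. F X xs mod G X xs)"
  using computable_diff[OF assms(1) computable_mult[OF assms(2) computable_div[OF assms]]]
  by (simp add: minus_mult_div_eq_mod)

lemma decidable_even:
  assumes "computable_on D k F"
  shows "decidable_on D k (\<lambda>X xs. even (F X xs))"
proof -
  have "decidable_on D k (\<lambda>X xs. F X xs mod 2 = 0)"
    by (intro decidable_eq computable_mod assms computable_const) simp
  then show ?thesis
    by (simp add: even_iff_mod_2_eq_zero)
qed

lemma computable_prod_encode:
  assumes "computable_on D k F" and "computable_on D k G"
  shows "computable_on D k (\<lambda>X xs. prod_encode (F X xs, G X xs))"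
  unfolding prod_encode_def triangle_def split
  by (intro computable_intros computable_div assms) simp

text \<open>The search for the first \<open>a\<close> that is a witness or exceeds the bound always
  halts, and testing where it stopped decides the quantifier. \<open>F'\<close> is the bound with
  the sought number in front of the arguments; \<open>sub\<close> allows the result of the search to
  be put back into \<open>P\<close>.\<close>

lemma decidable_bex_le:
  assumes P: "decidable_on D (Suc k) (\<lambda>X xs. P X (xs ! 0) (tl xs))"
    and F: "computable_on D k F" and F': "computable_on D (Suc k) (\<lambda>X xs. F X (tl xs))"
    and sub: "\<And>G. computable_on D k G \<Longrightarrow> decidable_on D k (\<lambda>X xs. P X (G X xs) xs)"
  shows "decidable_on D k (\<lambda>X xs. \<exists>a\<le>F X xs. P X a xs)"
proof -
  have "computable_on D k (\<lambda>X xs. LEAST a. P X a xs \<or> F X xs < a)"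
    by (rule computable_Least, intro computable_intros P F') auto
  from sub[OF this] decidable_le[OF this F]
  have "decidable_on D k (\<lambda>X xs. P X (LEAST a. P X a xs \<or> F X xs < a) xs \<and>
      (LEAST a. P X a xs \<or> F X xs < a) \<le> F X xs)"
    by (intro decidable_conj) auto
  moreover have "P X (LEAST a. P X a xs \<or> F X xs < a) xs \<and> (LEAST a. P X a xs \<or> F X xs < a) \<le> F X xs
      \<longleftrightarrow> (\<exists>a\<le>F X xs. P X a xs)" for X xs
  proof
    assume "\<exists>a\<le>F X xs. P X a xs"
    then obtain a where a: "a \<le> F X xs" "P X a xs"
      by blast
    have "(LEAST a. P X a xs \<or> F X xs < a) \<le> a"
      using a by (auto intro: Least_le)
    moreover have "P X (LEAST a. P X a xs \<or> F X xs < a) xs \<or> F X xs < (LEAST a. P X a xs \<or> F X xs < a)"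
      by (rule LeastI[of _ a]) (use a in auto)
    ultimately show "P X (LEAST a. P X a xs \<or> F X xs < a) xs \<and> (LEAST a. P X a xs \<or> F X xs < a) \<le> F X xs"
      using a by auto
  qed auto
  ultimately show ?thesis
    by simp
qed


section \<open>The coloring of the enlarged barrier, on codes\<close>

text \<open>In the following definitions \<open>X\<close> codes a coloring \<open>f\<close> of \<open>B\<close>, and \<open>a\<close> codes a finite set.\<close>

definition code_val :: "nat set \<Rightarrow> nat \<Rightarrow> nat" where
  "code_val X a = (LEAST v. 2 * a \<notin> X \<or> Suc (2 * prod_encode (a, v)) \<in> X)"

text \<open>Digit \<open>code_val X a\<close> of \<open>a\<close> is 0 and some higher digit is 1.
  For the code of \<open>s\<close> in \<open>B\<close> this means that \<open>s\<close> admits a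
  further step to \<open>u\<close>.\<close>

definition code_live :: "nat set \<Rightarrow> nat \<Rightarrow> bool" where
  "code_live X a \<longleftrightarrow>
     2 * a \<in> X \<and> 2 ^ code_val X a \<le> a \<and> even (a div 2 ^ code_val X a)"

text \<open>Adding the power of 2 inserts \<open>f s\<close>, and reduction modulo
  \<open>2 ^ k\<close> keeps the elements below \<open>k\<close>; so this is where
  \<open>s \<union> {f s}\<close> is cut to give \<open>u\<close>. The first disjunct stops the
  search at 0 when there is no step to take.\<close>

definition code_cut :: "nat set \<Rightarrow> nat \<Rightarrow> nat" where
  "code_cut X a =
     (LEAST k. \<not> code_live X a \<or> 2 * ((a + 2 ^ code_val X a) mod 2 ^ k) \<in> X)"

definition code_next :: "nat set \<Rightarrow> nat \<Rightarrow> nat" where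
  "code_next X a = (a + 2 ^ code_val X a) mod 2 ^ code_cut X a"

definition code_depth :: "nat set \<Rightarrow> nat \<Rightarrow> nat" where
  "code_depth X a = (LEAST j. \<not> code_live X ((code_next X ^^ j) a))"

text \<open>The position of the leading binary digit, which for a member of the enlarged barrier is
  the added element.\<close>

definition code_max :: "nat \<Rightarrow> nat" where
  "code_max x = (LEAST m. x < 2 ^ Suc m)"

text \<open>Deleting the leading digit and halving undoes first the addition of an element and then
  the shift.\<close>

definition code_stem :: "nat \<Rightarrow> nat" where
  "code_stem x = (x - 2 ^ code_max x) div 2"

text \<open>The added element is the shift of \<open>m\<close>, hence the \<open>Suc\<close> when it
  is compared with \<open>f s\<close>.\<close>

definition code_color :: "nat set \<Rightarrow> nat \<Rightarrow> nat" where
  "code_color X x =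
     (code_depth X (code_stem x) + of_bool (code_max x = Suc (code_val X (code_stem x)))) mod 2"

text \<open>Halving loses digit 0, so the equation rejects sets that contain 0 besides a larger
  element. The added element exceeds the shifted stem because it is the leading digit.\<close>

definition code_plus :: "nat set \<Rightarrow> nat \<Rightarrow> bool" where
  "code_plus X x \<longleftrightarrow> 2 * code_stem x \<in> X \<and> x = 2 * code_stem x + 2 ^ code_max x"

text \<open>Even and odd numbers are the two halves of the join that codes a coloring. Since
  \<open>x \<le> prod_encode (x, y)\<close>, the bound \<open>x \<le> n\<close> loses no witness and
  makes membership decidable.\<close>

definition code_coloring :: "nat set \<Rightarrow> nat set" where
  "code_coloring X =
     {n. even n \<and> code_plus X (n div 2) \<or>
         odd n \<and> (\<exists>x\<le>n. code_plus X x \<and> n div 2 = prod_encode (x, code_color X x))}"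

section \<open>Binary codes of finite sets and codes of colorings\<close>

lemma mem_set_decode_div: "v \<in> set_decode a \<longleftrightarrow> odd (a div 2 ^ v)"
  by (simp add: set_decode_def)

lemma set_decode_mod: "set_decode (n mod 2 ^ k) = set_decode n \<inter> {..<k}"
  by (auto simp: set_decode_def bit_iff_odd[symmetric] take_bit_eq_mod[symmetric] bit_take_bit_iff)

lemma set_encode_less:
  assumes "s \<subseteq> {..<m}"
  shows "set_encode s < 2 ^ m"
proof -
  have "finite s"
    using assms finite_subset by blast
  then have "set_encode s = set_encode s mod 2 ^ m"
    using assms by (metis set_decode_mod set_encode_inverse set_decode_inverse inf.absorb1)
  then show ?thesis
    by (metis mod_less_divisor zero_less_numeral zero_less_power)
qed

lemma set_encode_ge:
  assumes "finite s" and "m \<in> s"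
  shows "2 ^ m \<le> set_encode s"
  using member_le_sum[of m s "\<lambda>i. 2 ^ i :: nat"] assms by (simp add: set_encode_def)

lemma set_encode_Suc_image: "set_encode (Suc ` s) = 2 * set_encode s"
  by (simp add: set_encode_def sum.reindex sum_distrib_left)

lemma coloring_code_mem:
  assumes "\<forall>s\<in>B. finite s"
  shows "2 * a \<in> coloring_code B f \<longleftrightarrow> set_decode a \<in> B"
    and "Suc (2 * p) \<in> coloring_code B f \<longleftrightarrow>
      (\<exists>s\<in>B. p = prod_encode (set_encode s, f s))"
proof -
  have "(\<exists>s\<in>B. a = set_encode s) \<longleftrightarrow> set_decode a \<in> B"
    using assms by (metis set_decode_inverse set_encode_inverse)
  moreover have "2 * a \<in> coloring_code B f \<longleftrightarrow> (\<exists>s\<in>B. a = set_encode s)"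
    by (auto simp: coloring_code_def sum_encode_def double_not_eq_Suc_double)
  ultimately show "2 * a \<in> coloring_code B f \<longleftrightarrow> set_decode a \<in> B"
    by simp
  show "Suc (2 * p) \<in> coloring_code B f \<longleftrightarrow>
      (\<exists>s\<in>B. p = prod_encode (set_encode s, f s))"
    by (auto simp: coloring_code_def sum_encode_def Suc_double_not_eq_double)
qed

section \<open>The step from \<open>s\<close> to \<open>u\<close> and its termination\<close>

locale colored_barrier =
  fixes B :: "nat set set" and f :: "nat set \<Rightarrow> nat" and X :: "nat set"
  assumes barrier: "barrier_on B UNIV" and X: "X = coloring_code B f"
begin

lemma finite_B: "s \<in> B \<Longrightarrow> finite s"
  using barrier unfolding barrier_on_def by simp

lemma antichain: "s \<in> B \<Longrightarrow> t \<in> B \<Longrightarrow> s \<subseteq> t \<Longrightarrow> s = t"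
  using barrier unfolding barrier_on_def psubset_eq by simp

lemma initial_segment_ex: "infinite Z \<Longrightarrow> \<exists>u\<in>B. u \<sqsubset> Z"
  using barrier unfolding barrier_on_def by simp

lemma Union_B: "\<Union>B = UNIV"
  using barrier unfolding barrier_on_def by simp

text \<open>An empty member would, by the antichain property, be the only one, and then the base
  would be empty. This is what makes \<open>Max s\<close> an element of \<open>s\<close>.\<close>

lemma nonempty: "s \<in> B \<Longrightarrow> s \<noteq> {}"
proof
  assume "s \<in> B" "s = {}"
  then have "\<Union>B \<subseteq> {}"
    using antichain by blast
  then show False
    using Union_B by simp
qed

lemma mem_code: "2 * a \<in> X \<longleftrightarrow> set_decode a \<in> B"
  using coloring_code_mem(1)[of B a f] finite_B unfolding X by blast

lemma graph_code:
  assumes "s \<in> B"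
  shows "Suc (2 * prod_encode (set_encode s, v)) \<in> X \<longleftrightarrow> v = f s"
proof -
  have "Suc (2 * prod_encode (set_encode s, v)) \<in> X \<longleftrightarrow>
      (\<exists>t\<in>B. prod_encode (set_encode s, v) = prod_encode (set_encode t, f t))"
    using coloring_code_mem(2)[of B _ f] finite_B unfolding X by blast
  also have "\<dots> \<longleftrightarrow> (\<exists>t\<in>B. s = t \<and> v = f t)"
    using finite_B[OF assms] finite_B by (auto simp: prod_encode_eq set_encode_eq)
  finally show ?thesis
    using assms by blast
qed

text \<open>Minimization requires a halting search for every \<open>a\<close>; the first disjunct
  covers those that code no member of \<open>B\<close>.\<close>

lemma code_val_ex: "\<exists>v. 2 * a \<notin> X \<or> Suc (2 * prod_encode (a, v)) \<in> X"
  using graph_code[of "set_decode a" "f (set_decode a)"] mem_code[of a] by auto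

lemma code_val_eq:
  assumes "s \<in> B"
  shows "code_val X (set_encode s) = f s"
proof -
  have "2 * set_encode s \<in> X"
    using assms mem_code[of "set_encode s"] finite_B[OF assms] by simp
  then show ?thesis
    by (auto simp: code_val_def graph_code[OF assms] intro: Least_equality)
qed

lemma code_live_eq:
  assumes "s \<in> B"
  shows "code_live X (set_encode s) \<longleftrightarrow> f s \<notin> s \<and> f s < Max s"
proof -
  have "2 ^ f s \<le> set_encode s \<longleftrightarrow> f s \<le> Max s"
  proof
    assume "2 ^ f s \<le> set_encode s"
    moreover have "set_encode s < 2 ^ Suc (Max s)"
      using assms finite_B by (intro set_encode_less) (auto simp: less_Suc_eq_le)
    ultimately have "(2::nat) ^ f s < 2 ^ Suc (Max s)"
      by simp
    then show "f s \<le> Max s"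
      by (simp add: less_Suc_eq_le del: power_Suc)
  next
    assume "f s \<le> Max s"
    then have "(2::nat) ^ f s \<le> 2 ^ Max s"
      by simp
    also have "\<dots> \<le> set_encode s"
      using assms finite_B nonempty by (intro set_encode_ge) auto
    finally show "2 ^ f s \<le> set_encode s" .
  qed
  moreover have "odd (set_encode s div 2 ^ f s) \<longleftrightarrow> f s \<in> s"
    using assms finite_B mem_set_decode_div[of "f s" "set_encode s"] by simp
  \<comment> \<open>The digits give only \<open>f s \<le> Max s\<close>; equality is excluded when
    \<open>f s \<notin> s\<close>.\<close>
  moreover have "Max s \<in> s"
    using assms finite_B nonempty by simp
  ultimately have "2 ^ f s \<le> set_encode s \<and> even (set_encode s div 2 ^ f s) \<longleftrightarrow>
      f s \<notin> s \<and> f s < Max s"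
    by (metis le_neq_implies_less less_imp_le)
  then show ?thesis
    using assms finite_B[OF assms] by (simp add: code_live_def mem_code code_val_eq)
qed

text \<open>
  The initial segment in \<open>B\<close> of \<open>s \<union> {f s}\<close>, continued by everything beyond \<open>Max s\<close>, cannot
  contain \<open>Max s\<close>, since it would then properly contain \<open>s\<close>.
\<close>

lemma cut_ex:
  assumes s: "s \<in> B" and y: "y \<notin> s" "y < Max s"
  shows "\<exists>k. insert y s \<inter> {..<k} \<in> B"
proof -
  let ?Z = "insert y s \<union> {Max s<..}"
  have "infinite ?Z"
    using infinite_Ioi by blast
  from initial_segment_ex[OF this] obtain u where u: "u \<in> B" "u \<sqsubset> ?Z"
    by (elim bexE)
  have sub: "u \<subseteq> ?Z"
    using u(2) unfolding proper_initial_segment_def by (elim conjE psubset_imp_subset)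
  have init: "z \<in> u" if "x \<in> u" "z \<in> ?Z" "z < x" for x z
    using u(2) that unfolding proper_initial_segment_def by metis
  have M: "Max s \<in> s" "\<And>x. x \<in> s \<Longrightarrow> x \<le> Max s"
    using s finite_B nonempty by auto
  have "Max s \<notin> u"
  proof
    assume max: "Max s \<in> u"
    have "z \<in> u" if "z \<in> insert y s" for z
      using that init[OF max, of z] max M(2)[of z] y(2) by (cases "z = Max s") auto
    then show False
      using antichain[OF s u(1)] y(1) by blast
  qed
  then have "x < Max s" if "x \<in> u" for x
    using that init[OF that, of "Max s"] M(1) by (metis UnI1 insertI2 linorder_neqE_nat)
  then have "u \<subseteq> insert y s"
    using sub by fastforce
  \<comment> \<open>The cut is placed just above \<open>Max u\<close>: all elements of
    \<open>insert y s\<close> up to there lie in \<open>u\<close>, as \<open>u\<close> is initial in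
    \<open>?Z\<close>.\<close>
  moreover have "insert y s \<inter> {..<Suc (Max u)} \<subseteq> u"
    using init[of "Max u"] Max_in[OF finite_B nonempty, OF u(1) u(1)]
    by (auto simp: less_Suc_eq)
  ultimately have "u = insert y s \<inter> {..<Suc (Max u)}"
    using finite_B[OF u(1)] by (auto simp: less_Suc_eq_le)
  then show ?thesis
    using u(1) by metis
qed

text \<open>Digit \<open>f s\<close> is 0, so the addition has no carry.\<close>

lemma code_add:
  assumes "s \<in> B" and "f s \<notin> s"
  shows "set_encode s + 2 ^ code_val X (set_encode s) = set_encode (insert (f s) s)"
  using assms finite_B by (simp add: code_val_eq)

lemma code_cut_ex: "\<exists>k. \<not> code_live X a \<or> 2 * ((a + 2 ^ code_val X a) mod 2 ^ k) \<in> X"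
proof (cases "code_live X a")
  case True
  define s where "s = set_decode a"
  have a: "a = set_encode s"
    by (simp add: s_def)
  have s: "s \<in> B"
    using True mem_code unfolding code_live_def s_def by simp
  then have y: "f s \<notin> s" "f s < Max s"
    using True code_live_eq unfolding a by auto
  show ?thesis
    using cut_ex[OF s y] finite_B[OF s] unfolding a code_add[OF s y(1)] mem_code set_decode_mod
    by simp
qed auto

lemma code_next_props:
  assumes s: "s \<in> B" and live: "code_live X (set_encode s)"
  shows "set_decode (code_next X (set_encode s)) \<in> B"
    and "set_decode (code_next X (set_encode s)) \<subseteq> insert (f s) s"
    and "code_next X (set_encode s) < set_encode s"
proof -
  let ?n = "code_next X (set_encode s)" and ?k = "code_cut X (set_encode s)"
  have y: "f s \<notin> s" "f s < Max s"
    using live code_live_eq[OF s] by auto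
  show B: "set_decode ?n \<in> B"
    using LeastI_ex[OF code_cut_ex[of "set_encode s"]] live
    unfolding code_cut_def[symmetric] by (simp add: code_next_def mem_code)
  have dec: "set_decode ?n = insert (f s) s \<inter> {..<?k}"
    unfolding code_next_def set_decode_mod code_add[OF s y(1)]
    using finite_B[OF s] by simp
  then show "set_decode ?n \<subseteq> insert (f s) s"
    by blast
  \<comment> \<open>A cut beyond \<open>Max s\<close> would put all of \<open>insert (f s) s\<close>
    into \<open>B\<close>, properly above \<open>s\<close>. So \<open>Max s\<close> is removed,
    which makes the code smaller.\<close>
  have "?k \<le> Max s"
  proof (rule ccontr)
    assume "\<not> ?k \<le> Max s"
    moreover have "x \<le> Max s" if "x \<in> insert (f s) s" for x
      using that y(2) finite_B[OF s] by auto
    ultimately have "set_decode ?n = insert (f s) s"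
      unfolding dec by (auto simp: not_le intro: le_less_trans)
    then show False
      using antichain[OF s B] y(1) by blast
  qed
  then have "set_encode (set_decode ?n) < 2 ^ Max s"
    unfolding dec by (intro set_encode_less) auto
  also have "\<dots> \<le> set_encode s"
    using s finite_B nonempty by (intro set_encode_ge) auto
  finally show "?n < set_encode s"
    by simp
qed

text \<open>Codes decrease strictly along live steps, and any code that is not live stops at
  once.\<close>

lemma code_depth_ex: "\<exists>j. \<not> code_live X ((code_next X ^^ j) a)"
proof (induction a rule: less_induct)
  case (less a)
  show ?case
  proof (cases "code_live X a")
    case True
    have "set_decode a \<in> B"
      using True mem_code unfolding code_live_def by simp
    then have "code_next X a < a"
      using code_next_props(3)[of "set_decode a"] True by simp
    then obtain j where "\<not> code_live X ((code_next X ^^ j) (code_next X a))"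
      using less by blast
    then show ?thesis
      by (intro exI[of _ "Suc j"]) (simp add: funpow_swap1)
  next
    case False
    then show ?thesis
      by (intro exI[of _ 0]) simp
  qed
qed

text \<open>The change of parity that gives \<open>s\<close> and \<open>u\<close> different
  colors.\<close>

lemma code_depth_next:
  assumes "code_live X a"
  shows "code_depth X a = Suc (code_depth X (code_next X a))"
proof -
  obtain j where "\<not> code_live X ((code_next X ^^ j) a)"
    using code_depth_ex by blast
  then show ?thesis
    unfolding code_depth_def using assms
    by (subst Least_Suc[of _ j]) (simp_all add: funpow_swap1)
qed

end

section \<open>Decoding members of the enlarged barrier\<close>

lemma code_max_ex: "\<exists>m. (x::nat) < 2 ^ Suc m"
proof
  show "x < 2 ^ Suc x"
    using less_exp[of "Suc x"] by linarith
qed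

lemma code_max_eq:
  assumes "s \<subseteq> {..<m}"
  shows "code_max (2 ^ m + set_encode s) = m"
  unfolding code_max_def
proof (rule Least_equality)
  show "2 ^ m + set_encode s < 2 ^ Suc m"
    using set_encode_less[OF assms] by simp
  show "m \<le> k" if "2 ^ m + set_encode s < 2 ^ Suc k" for k
  proof -
    have "(2::nat) ^ m < 2 ^ Suc k"
      using that by linarith
    then show ?thesis
      by (simp add: less_Suc_eq_le del: power_Suc)
  qed
qed

context colored_barrier
begin

lemma code_plus_props:
  assumes s: "s \<in> B" and m: "Max s < m"
  shows "set_encode (Suc ` s \<union> {Suc m}) = 2 ^ Suc m + 2 * set_encode s"
    and "code_max (2 ^ Suc m + 2 * set_encode s) = Suc m"
    and "code_stem (2 ^ Suc m + 2 * set_encode s) = set_encode s"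
proof -
  have lt: "x < m" if "x \<in> s" for x
    using that m finite_B[OF s] by (meson Max_ge le_less_trans)
  then have "Suc m \<notin> Suc ` s"
    by auto
  then show "set_encode (Suc ` s \<union> {Suc m}) = 2 ^ Suc m + 2 * set_encode s"
    using finite_B[OF s] by (simp add: set_encode_Suc_image del: power_Suc)
  have "Suc ` s \<subseteq> {..<Suc m}"
    using lt by auto
  then show "code_max (2 ^ Suc m + 2 * set_encode s) = Suc m"
    using code_max_eq[of "Suc ` s" "Suc m"] by (simp only: set_encode_Suc_image)
  then show "code_stem (2 ^ Suc m + 2 * set_encode s) = set_encode s"
    by (simp add: code_stem_def del: power_Suc)
qed

text \<open>The base is all of the natural numbers, so the added element may be any successor;
  writing it as \<open>Suc m\<close> turns its lower bound into \<open>Max s < m\<close>.\<close>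

lemma barrier_plus_mem_iff:
  "t \<in> barrier_plus B \<longleftrightarrow> (\<exists>s m. s \<in> B \<and> Max s < m \<and> t = Suc ` s \<union> {Suc m})"
  unfolding barrier_plus_def Union_B by auto

lemma finite_barrier_plus: "t \<in> barrier_plus B \<Longrightarrow> finite t"
  using finite_B unfolding barrier_plus_mem_iff by auto

lemma code_plus_iff: "code_plus X a \<longleftrightarrow> (\<exists>t\<in>barrier_plus B. a = set_encode t)"
proof
  assume "\<exists>t\<in>barrier_plus B. a = set_encode t"
  then obtain s m where s: "s \<in> B" and m: "Max s < m" and a: "a = set_encode (Suc ` s \<union> {Suc m})"
    using barrier_plus_mem_iff by auto
  show "code_plus X a"
    unfolding code_plus_def mem_code a code_plus_props[OF s m] using s finite_B[OF s] by simp
next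
  assume a: "code_plus X a"
  define s where "s = set_decode (code_stem a)"
  have s: "s \<in> B" and eq: "a = 2 * set_encode s + 2 ^ code_max a"
    using a unfolding code_plus_def mem_code s_def by auto
  have "a < 2 ^ Suc (code_max a)"
    using LeastI_ex[OF code_max_ex] unfolding code_max_def .
  \<comment> \<open>The leading digit dominates the remainder, which yields the required gap above
    \<open>Max s\<close>.\<close>
  then have lt: "2 * set_encode s < 2 ^ code_max a"
    using eq by simp
  have "(2::nat) ^ Suc (Max s) \<le> 2 * set_encode s"
    using set_encode_ge[of s "Max s"] s finite_B nonempty by simp
  then have "(2::nat) ^ Suc (Max s) < 2 ^ code_max a"
    using lt by simp
  then have "Suc (Max s) < code_max a"
    by (simp del: power_Suc)
  then obtain m where m: "code_max a = Suc m" "Max s < m"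
    by (metis Suc_lessE)
  then have "a = set_encode (Suc ` s \<union> {Suc m})"
    using code_plus_props(1)[OF s m(2)] eq by simp
  then show "\<exists>t\<in>barrier_plus B. a = set_encode t"
    using s m(2) barrier_plus_mem_iff by blast
qed

lemma code_coloring_eq:
  "code_coloring X = coloring_code (barrier_plus B) (\<lambda>t. code_color X (set_encode t))"
    (is "_ = coloring_code ?C ?g")
proof (rule set_eqI)
  fix n
  show "n \<in> code_coloring X \<longleftrightarrow> n \<in> coloring_code ?C ?g"
  proof (cases "even n")
    case True
    then obtain a where n: "n = 2 * a"
      by blast
    have "set_decode a \<in> ?C \<longleftrightarrow> (\<exists>t\<in>?C. a = set_encode t)"
      using finite_barrier_plus by (metis set_decode_inverse set_encode_inverse)
    then show ?thesis
      using coloring_code_mem(1)[of ?C a ?g] finite_barrier_plus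
      by (simp add: n code_coloring_def code_plus_iff)
  next
    case False
    then obtain p where n: "n = Suc (2 * p)"
      by (metis oddE Suc_eq_plus1)
    have "a \<le> Suc (2 * prod_encode (a, b))" for a b
      using le_prod_encode_1[of a b] by simp
    then show ?thesis
      using coloring_code_mem(2)[of ?C p ?g] finite_barrier_plus
      by (auto simp: n code_coloring_def code_plus_iff)
  qed
qed

section \<open>From homogeneous sets to free sets\<close>

lemma homogeneous_free:
  assumes "homogeneous_for (barrier_plus B) (\<lambda>t. code_color X (set_encode t)) H"
  shows "free_for B f {x. Suc x \<in> H}"
proof -
  let ?Y = "{x. Suc x \<in> H}"
  obtain c where H: "infinite H"
    and c: "\<And>t. t \<in> barrier_plus B \<Longrightarrow> t \<subseteq> H \<Longrightarrow> code_color X (set_encode t) = c"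
    using assms unfolding homogeneous_for_def barrier_restrict_def by blast
  \<comment> \<open>The shift can lose only the element 0, so \<open>?Y\<close> stays
    infinite.\<close>
  have "H \<subseteq> insert 0 (Suc ` ?Y)"
    by (auto simp: image_iff) (metis not0_implies_Suc)
  then have Y: "infinite ?Y"
    using H by (meson finite_imageI finite_insert finite_subset)
  have color: "(code_depth X (set_encode s) + of_bool (m = f s)) mod 2 = c"
    if "s \<in> B" "s \<subseteq> ?Y" "m \<in> ?Y" "Max s < m" for s m
  proof -
    have "Suc ` s \<union> {Suc m} \<in> barrier_plus B"
      using that barrier_plus_mem_iff by blast
    moreover have "Suc ` s \<union> {Suc m} \<subseteq> H"
      using that by auto
    ultimately have "code_color X (set_encode (Suc ` s \<union> {Suc m})) = c"
      by (rule c)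
    then show ?thesis
      unfolding code_plus_props[OF that(1,4)] code_color_def code_val_eq[OF that(1)] by simp
  qed
  have "f s \<in> s" if s: "s \<in> B" "s \<subseteq> ?Y" and y: "f s \<in> ?Y" for s
  proof (rule ccontr)
    assume ns: "f s \<notin> s"
    show False
    proof (cases "f s < Max s")
      case True
      define u where "u = set_decode (code_next X (set_encode s))"
      have live: "code_live X (set_encode s)"
        using code_live_eq[OF s(1)] True ns by blast
      have u: "u \<in> B" "u \<subseteq> ?Y"
        using code_next_props(1,2)[OF s(1) live] s(2) y unfolding u_def by blast+
      \<comment> \<open>Beyond both maxima, the same \<open>m\<close> extends \<open>s\<close> and
        \<open>u\<close>; beyond \<open>f s\<close> and \<open>f u\<close>, both indicators vanish
        and the colors are the parities of two consecutive depths.\<close>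
      obtain m where m: "m \<in> ?Y" "m > Max s + Max u + f s + f u"
        using Y infinite_nat_iff_unbounded by blast
      have "code_depth X (set_encode s) = Suc (code_depth X (set_encode u))"
        using code_depth_next[OF live] unfolding u_def by simp
      then show False
        using color[OF s m(1)] color[OF u m(1)] m(2) by simp presburger
    next
      case False
      have "Max s \<in> s"
        using s(1) finite_B nonempty by simp
      then have lt: "Max s < f s"
        using False ns by (metis linorder_neqE_nat)
      obtain m where m: "m \<in> ?Y" "m > f s"
        using Y infinite_nat_iff_unbounded by blast
      show False
        using color[OF s y lt] color[OF s m(1)] m(2) lt by simp presburger
    qed
  qed
  then show ?thesis
    using Y unfolding free_for_def barrier_restrict_def Union_B by simp
qed

end

section \<open>Uniform computability of the coloring\<close>

lemma decidable_code_coloring: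
  assumes "barrier_on B UNIV"
  shows "decidable_on {coloring_code B f | f. True} 1 (\<lambda>X xs. xs ! 0 \<in> code_coloring X)"
proof -
  define D where "D = {coloring_code B f | f. True}"
  \<comment> \<open>Every oracle in \<open>D\<close> codes a coloring of the same barrier, so the
    existence lemmas of the locale make each search below total.\<close>
  have D: "\<exists>f. colored_barrier B f X" if "X \<in> D" for X
    using that assms unfolding D_def colored_barrier_def by blast
  have val: "computable1 D code_val"
    unfolding code_val_def
  proof (rule computable_Least)
    show "\<exists>v. 2 * (xs ! 0) \<notin> X \<or> Suc (2 * prod_encode (xs ! 0, v)) \<in> X"
      if "X \<in> D" for X and xs :: "nat list"
      using D[OF that] colored_barrier.code_val_ex by blast
  qed (intro computable_intros computable_prod_encode; simp)
  have live: "computable1 D (\<lambda>X a. of_bool (code_live X a))"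
    unfolding code_live_def
    by (intro computable_intros decidable_even computable_div computable1_app[OF val]; simp)
  have cut: "computable1 D code_cut"
    unfolding code_cut_def
  proof (rule computable_Least)
    show "\<exists>k. \<not> code_live X (xs ! 0) \<or>
        2 * ((xs ! 0 + 2 ^ code_val X (xs ! 0)) mod 2 ^ k) \<in> X"
      if "X \<in> D" for X and xs :: "nat list"
      using D[OF that] colored_barrier.code_cut_ex by blast
  qed (intro computable_intros computable_mod computable1_app[OF val] computable1_app[OF live]; simp)
  have "next": "computable1 D code_next"
    unfolding code_next_def
    by (intro computable_intros computable_mod computable1_app[OF val] computable1_app[OF cut]; simp)
  have depth: "computable1 D code_depth"
    unfolding code_depth_def
  proof (rule computable_Least)
    show "\<exists>j. \<not> code_live X ((code_next X ^^ j) (xs ! 0))"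
      if "X \<in> D" for X and xs :: "nat list"
      using D[OF that] colored_barrier.code_depth_ex by blast
  qed (intro computable_intros computable_funpow[OF "next"] computable1_app[OF live]; simp)
  have max: "computable1 D (\<lambda>X. code_max)"
    unfolding code_max_def
  proof (rule computable_Least)
    show "\<exists>m. xs ! 0 < 2 ^ Suc m" for xs :: "nat list"
      by (rule code_max_ex)
  qed (intro computable_intros; simp)
  have stem: "computable1 D (\<lambda>X. code_stem)"
    unfolding code_stem_def
    by (intro computable_intros computable_div computable1_app[OF max]; simp)
  have color: "computable1 D code_color"
    unfolding code_color_def
    by (intro computable_intros computable_mod computable1_app[OF val] computable1_app[OF depth]
        computable1_app[OF max] computable1_app[OF stem]; simp)
  have plus: "computable1 D (\<lambda>X x. of_bool (code_plus X x))"
    unfolding code_plus_def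
    by (intro computable_intros computable1_app[OF max] computable1_app[OF stem]; simp)
  have "decidable_on D 1 (\<lambda>X xs. \<exists>x\<le>xs ! 0. code_plus X x \<and>
      xs ! 0 div 2 = prod_encode (x, code_color X x))"
  proof (rule decidable_bex_le)
    show "decidable_on D 1 (\<lambda>X xs. code_plus X (G X xs) \<and>
        xs ! 0 div 2 = prod_encode (G X xs, code_color X (G X xs)))" if "computable_on D 1 G" for G
      by (intro computable_intros computable_prod_encode computable_div computable1_app[OF plus]
          computable1_app[OF color] that; simp)
  qed (intro computable_intros computable_prod_encode computable_div computable1_app[OF plus]
      computable1_app[OF color]; simp)+
  then have "decidable_on D 1 (\<lambda>X xs. xs ! 0 \<in> code_coloring X)"
    unfolding code_coloring_def mem_Collect_eq
    by (intro decidable_conj decidable_disj decidable_not decidable_even computable_div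
        computable1_app[OF plus] computable_nth computable_const; simp)
  then show ?thesis
    unfolding D_def .
qed

section \<open>The strong Weihrauch reduction\<close>

theorem theorem6:
  fixes B :: "nat set set"
  assumes "barrier_on B UNIV"
  shows "FS B \<le>\<^sub>s\<^sub>W RT (barrier_plus B) 2"
proof -
  obtain \<Phi> where \<Phi>: "\<And>X xs. X \<in> {coloring_code B f | f. True} \<Longrightarrow> length xs = 1 \<Longrightarrow>
      recf_val X \<Phi> xs = Some (of_bool (xs ! 0 \<in> code_coloring X))"
    using decidable_code_coloring[OF assms] unfolding computable_on_def by blast
  \<comment> \<open>The backward functional only asks whether \<open>x + 1\<close> is in
    \<open>H\<close>. It does not consult the instance, as strong reducibility demands.\<close>
  define \<Psi> where "\<Psi> = RComp ROracle [RSucc]"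
  have \<Psi>: "computes \<Psi> H {x. Suc x \<in> H}" for H
    by (simp add: computes_def \<Psi>_def)
  show ?thesis
    unfolding strong_Weihrauch_le_def
  proof (rule exI[of _ \<Phi>], rule exI[of _ \<Psi>], rule ballI)
    fix I assume "I \<in> instances (FS B)"
    then obtain f where I: "I = coloring_code B f"
      unfolding FS_def by auto
    interpret colored_barrier B f I
      using assms I by unfold_locales
    let ?C = "barrier_plus B" and ?g = "\<lambda>t. code_color I (set_encode t)"
    have "I \<in> {coloring_code B f | f. True}"
      using I by blast
    then have "computes \<Phi> I (code_coloring I)"
      using \<Phi> unfolding computes_def by simp
    moreover have "code_coloring I \<in> instances (RT ?C 2)"
      unfolding RT_def code_coloring_eq by (auto simp: code_color_def)
    moreover have "{x. Suc x \<in> H} \<in> solutions (FS B) I"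
      if "H \<in> solutions (RT ?C 2) (code_coloring I)" for H
    proof -
      have "\<exists>g. coloring_code ?C ?g = coloring_code ?C g \<and> homogeneous_for ?C g H"
        using that unfolding RT_def code_coloring_eq by simp
      then obtain g where g: "coloring_code ?C ?g = coloring_code ?C g" "homogeneous_for ?C g H"
        by (elim exE conjE)
      \<comment> \<open>A solution comes with some coloring \<open>g\<close> having the given code;
        the code determines the coloring on \<open>?C\<close>, so \<open>g\<close> may be replaced
        by \<open>?g\<close>.\<close>
      then have "\<forall>s\<in>?C. ?g s = g s"
        using coloring_code_eq_iff[of ?C ?C ?g g] finite_barrier_plus by simp
      then have "homogeneous_for ?C ?g H"
        using g(2) unfolding homogeneous_for_def barrier_restrict_def by simp
      then have "free_for B f {x. Suc x \<in> H}"
        by (rule homogeneous_free)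
      then show ?thesis
        using I unfolding FS_def by auto
    qed
    ultimately show "\<exists>J. computes \<Phi> I J \<and> J \<in> instances (RT ?C 2) \<and>
        (\<forall>Y\<in>solutions (RT ?C 2) J. \<exists>Z. computes \<Psi> Y Z \<and> Z \<in> solutions (FS B) I)"
      using \<Psi> by blast
  qed
qed

end
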